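(* Let $f(z)=z+\sum_{n=2}^{\infty}a_nz^n\in\mathcal{S}_{\mathbb{R}}$ and let $\lambda\ge1$ be real. Then for all integers $n,m\ge2$, $$|\lambda a_na_m-a_{n+m-1}|\le\lambda mn-n-m+1.$$ The result is sharp: for every real $\lambda\ge 1$ and all integers $n,m\ge2$, equality is attained by some function in $\mathcal{S}_{\mathbb{R}}$.
   Context: $\mathbb{D}$ is the open unit disc and $\mathcal{A}$ is the class of analytic functions on $\mathbb{D}$ of the form $f(z)=z+a_2z^2+a_3z^3+\cdots$. $\mathcal{S}_{\mathbb{R}}$ is the class of univalent (injective) functions $f\in\mathcal{A}$ all of whose Taylor coefficients $a_n$ are real. *)

theory Defs
  imports "HOL-Complex_Analysis.Complex_Analysis"
begin

abbreviation unit_disc :: "complex set" (\<open>\<D>\<close>)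
  where "\<D> \<equiv> ball 0 1"

definition taylor_coeff :: "(complex \<Rightarrow> complex) \<Rightarrow> nat \<Rightarrow> complex"
  where "taylor_coeff f n = fps_nth (fps_expansion f 0) n"

text \<open>Functions here are total, so membership in these classes constrains a function
  on \<open>\<D>\<close> only.\<close>

definition class_A :: "(complex \<Rightarrow> complex) set"
  where "class_A = {f. f analytic_on \<D> \<and> taylor_coeff f 0 = 0 \<and> taylor_coeff f 1 = 1}"

definition class_S_real :: "(complex \<Rightarrow> complex) set"
  where "class_S_real = {f \<in> class_A. inj_on f \<D> \<and> (\<forall>n. taylor_coeff f n \<in> \<real>)}"

lemma taylor_coeff_eq: "taylor_coeff f n = (deriv ^^ n) f 0 / fact n"
  by (simp add: taylor_coeff_def fps_expansion_def)

lemma class_A_expansion: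
  assumes "f \<in> class_A" and "z \<in> \<D>"
  shows "(\<lambda>n. taylor_coeff f (n + 2) * z ^ (n + 2)) sums (f z - z)"
proof -
  have "f holomorphic_on \<D>"
    using assms(1) by (simp add: class_A_def analytic_imp_holomorphic)
  then have "(\<lambda>n. taylor_coeff f n * z ^ n) sums f z"
    using holomorphic_power_series[of f 0 1 z] assms(2) by (simp add: taylor_coeff_eq)
  then have "(\<lambda>n. taylor_coeff f (n + 2) * z ^ (n + 2)) sums
      (f z - (\<Sum>n<2. taylor_coeff f n * z ^ n))"
    by (rule sums_split_initial_segment)
  then show ?thesis
    using assms(1) by (simp add: class_A_def numeral_2_eq_2)
qed

end

theory Submission
  imports Defs "HOL-Real_Asymp.Real_Asymp"
begin

text \<open>
The case \<open>\<lambda> = 1\<close> is the generalised Zalcman inequality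
\<open>\<bar>a\<^sub>n a\<^sub>m - a\<^sub>n\<^sub>+\<^sub>m\<^sub>-\<^sub>1\<bar> \<le> (n - 1) (m - 1)\<close>, and it implies the others: what is added is
\<open>(\<lambda> - 1) a\<^sub>n a\<^sub>m\<close>, at most \<open>(\<lambda> - 1) n m\<close> in modulus. The Koebe function, with \<open>a\<^sub>n = n\<close>, attains
equality.

A univalent function with real coefficients is typically real: \<open>Im f\<close> has the sign of \<open>Im z\<close>. Hence
\<open>Im f(t e\<^sup>i\<^sup>x) sin x\<close> is, up to a constant, a probability weight on the circle, and the differences
\<open>p\<^sub>k = a\<^sub>k\<^sub>+\<^sub>1 - a\<^sub>k\<^sub>-\<^sub>1\<close> are twice its cosine moments as \<open>t\<close> tends to 1. A short computation with
such moments gives Livingston's inequality \<open>\<bar>p\<^sub>k p\<^sub>l - p\<^sub>k\<^sub>+\<^sub>l\<bar> \<le> 2\<close>, together with \<open>\<bar>p\<^sub>k\<bar> \<le> 2\<close>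
(\<open>class_S_real_livingston_inequality\<close>).

The Zalcman differences are sums of Livingston differences. Raising \<open>n\<close> by 2 changes
\<open>a\<^sub>n a\<^sub>m - a\<^sub>n\<^sub>+\<^sub>m\<^sub>-\<^sub>1\<close> by \<open>p\<^sub>n\<^sub>+\<^sub>1 a\<^sub>m - p\<^sub>n\<^sub>+\<^sub>m\<close>, and raising \<open>m\<close> by 2 changes that by
\<open>p\<^sub>k p\<^sub>l - p\<^sub>k\<^sub>+\<^sub>l + p\<^sub>k\<^sub>+\<^sub>l\<^sub>-\<^sub>2\<close> with \<open>k = n + 1\<close> and \<open>l = m + 1\<close>; the bounds add up exactly
(\<open>livingston_sequence.zalcman\<close>). The induction in steps of 2 leaves one starting value that
typical reality alone does not give, \<open>\<bar>a\<^sub>2\<^sup>2 - a\<^sub>3\<bar> \<le> 1\<close>. The quantity inside is the coefficient of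
\<open>z\<close> in \<open>1/f(z)\<close>, and the bound is an instance of the area theorem (\<open>laurent_area_theorem\<close>), proved
here by comparing the area of the image of an annulus with that of an ellipse around it.\<close>

section \<open>Sequences satisfying Livingston's inequality\<close>

text \<open>If \<open>a n\<close> is the mean of \<open>sin nx / sin x\<close> for some probability measure, then \<open>cos_coeff a k\<close> is
twice the mean of \<open>cos kx\<close>, for \<open>k \<ge> 1\<close>.\<close>

definition cos_coeff :: "(nat \<Rightarrow> real) \<Rightarrow> nat \<Rightarrow> real" where
  "cos_coeff a k = a (k + 1) - a (k - 1)"

lemma two_step_induct [consumes 1, case_names one two step]:
  fixes n :: nat
  assumes "n \<ge> 1" and "P 1" "P 2" and "\<And>n. n \<ge> 1 \<Longrightarrow> P n \<Longrightarrow> P (n + 2)"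
  shows "P n"
proof -
  have "P (Suc k) \<and> P (Suc (Suc k))" for k
    using assms(2-4) by (induction k) (auto simp: numeral_2_eq_2)
  then show ?thesis using \<open>n \<ge> 1\<close> by (cases n) auto
qed

text \<open>The part of the information about the coefficients that enters the induction below. It holds for
every typically real function; univalence is used only through the extra hypothesis on
\<open>a 2\<close> and \<open>a 3\<close> in the final lemma of this section.\<close>

locale livingston_sequence =
  fixes a :: "nat \<Rightarrow> real"
  assumes a0: "a 0 = 0" and a1: "a 1 = 1"
    and liv: "\<And>k l. k \<ge> 1 \<Longrightarrow> l \<ge> 1 \<Longrightarrow>
         \<bar>cos_coeff a k * cos_coeff a l - cos_coeff a (k + l)\<bar> \<le> 2"
    and bd: "\<And>k. k \<ge> 1 \<Longrightarrow> \<bar>cos_coeff a k\<bar> \<le> 2"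
begin

lemma two_step: "a (Suc (Suc n)) = a n + cos_coeff a (Suc n)"
  by (simp add: cos_coeff_def)

lemma a2: "a 2 = cos_coeff a 1"
  using a0 by (simp add: cos_coeff_def numeral_2_eq_2)

lemma growth: "n \<ge> 1 \<Longrightarrow> \<bar>a n\<bar> \<le> n"
proof (induction n rule: two_step_induct)
  case (step n) then show ?case using bd[of "n+1"] by (simp add: two_step)
qed (use a1 bd[of 1] a2 in auto)

text \<open>Raising \<open>m\<close> by 2 changes the left-hand side by a Livingston difference and one single moment, each
at most 2, which matches the increase 4 of the bound.\<close>

lemma cos_coeff_mult_bound:
  assumes "k \<ge> 1" "m \<ge> 1"
  shows "\<bar>cos_coeff a k * a m - cos_coeff a (k + m - 1)\<bar> \<le> 2 * (real m - 1)"
  using assms(2)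
proof (induction m rule: two_step_induct)
  case (step m)
  let ?p = "cos_coeff a"
  have "?p k * a (m + 2) - ?p (k + (m + 2) - 1) =
     (?p k * a m - ?p (k + m - 1)) + (?p k * ?p (m + 1) - ?p (k + (m + 1))) + ?p (k + m - 1)"
    using step(1) by (simp add: two_step algebra_simps)
  moreover have "\<bar>?p k * ?p (m + 1) - ?p (k + (m + 1))\<bar> \<le> 2" using assms by (intro liv) auto
  moreover have "\<bar>?p (k + m - 1)\<bar> \<le> 2" using assms step by (intro bd) auto
  moreover have "\<bar>?p k * a m - ?p (k + m - 1)\<bar> \<le> 2 * (real m - 1)" using step by simp
  moreover have "2 * (real (m + 2) - 1) = 2 * (real m - 1) + 2 + 2" by simp
  moreover have "\<bar>x + y + z\<bar> \<le> c + 2 + 2" if "\<bar>y\<bar> \<le> 2" "\<bar>z\<bar> \<le> 2" "\<bar>x\<bar> \<le> c" for x y z c :: real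
    using that by linarith
  ultimately show ?case by (simp only:)
next
  case two show ?case using liv[of k 1] assms a2 by (simp add: mult.commute)
qed (use a1 in simp)

text \<open>The bound \<open>(n - 1) (m - 1)\<close> grows by \<open>2 (m - 1)\<close> when \<open>n\<close> grows by 2, and the
left-hand side by no more than that, by the preceding lemma. The induction starts at \<open>n = 1\<close>, where the difference is 0, and at
\<open>n = 2\<close>; the latter row is handled by the same kind of induction on \<open>m\<close>, started at
\<open>m = 1\<close> and \<open>m = 2\<close>. The corner \<open>n = m = 2\<close> is the one place that positivity does not reach: for
\<open>z (1 + z\<^sup>2) / (1 - z\<^sup>2)\<^sup>2\<close>, whose coefficients are \<open>a 2 = 0\<close> and \<open>a 3 = 3\<close>, it fails.\<close>

lemma zalcman:
  assumes area: "\<bar>(a 2)\<^sup>2 - a 3\<bar> \<le> 1" and "n \<ge> 1" "m \<ge> 1"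
  shows "\<bar>a n * a m - a (n + m - 1)\<bar> \<le> (real n - 1) * (real m - 1)"
proof -
  let ?p = "cos_coeff a"
  have second_row: "\<bar>a 2 * a m - a (m + 1)\<bar> \<le> real m - 1" if "m \<ge> 1" for m
    using that
  proof (induction m rule: two_step_induct)
    case (step m)
    have "a 2 * a (m + 2) - a (m + 2 + 1) = (a 2 * a m - a (m + 1)) + (?p 1 * ?p (m + 1) - ?p (1 + (m + 1)))"
      by (simp add: two_step a2 algebra_simps)
    moreover have "\<bar>?p 1 * ?p (m + 1) - ?p (1 + (m + 1))\<bar> \<le> 2" by (intro liv) auto
    moreover have "\<bar>a 2 * a m - a (m + 1)\<bar> \<le> real m - 1" using step by simp
    moreover have "real (m + 2) = real m + 2" by simp
    ultimately show ?case by linarith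
  next
    case two show ?case using area by (simp add: power2_eq_square)
  qed (use a1 in \<open>simp add: numeral_2_eq_2\<close>)
  show ?thesis using \<open>n \<ge> 1\<close>
  proof (induction n rule: two_step_induct)
    case two show ?case using second_row[OF \<open>m \<ge> 1\<close>] by simp
  next
    case (step n)
    define j where "j = n + m - 1"
    have j: "n + m - 1 = j" "n + 2 + m - 1 = Suc (Suc j)" "n + 1 + m - 1 = Suc j"
      using assms by (auto simp: j_def)
    have "a (n + 2) * a m - a (n + 2 + m - 1) = (a n * a m - a (n + m - 1))
        + (?p (n + 1) * a m - ?p (n + 1 + m - 1))"
      unfolding j by (simp add: two_step algebra_simps)
    moreover have "\<bar>a n * a m - a (n + m - 1)\<bar> \<le> (real n - 1) * (real m - 1)" using step by simp
    moreover have "\<bar>?p (n + 1) * a m - ?p (n + 1 + m - 1)\<bar> \<le> 2 * (real m - 1)"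
      using assms by (intro cos_coeff_mult_bound) auto
    moreover have "(real (n + 2) - 1) * (real m - 1) = (real n - 1) * (real m - 1) + 2 * (real m - 1)"
      by (simp add: algebra_simps)
    ultimately show ?case by linarith
  qed (use a1 in simp)
qed

end

section \<open>Typically real functions and their cosine moments\<close>

lemma circle_coeff_integral:
  fixes F :: "complex \<Rightarrow> complex"
  assumes F: "F holomorphic_on ball 0 R" and t: "0 < t" "t < R"
  shows "((\<lambda>x. F (t * cis x) * cis (- (of_nat n * x))) has_integral
           2 * pi * t ^ n * taylor_coeff F n) {0..2*pi}"
proof -
  have sub: "cball 0 t \<subseteq> ball (0::complex) R" "ball 0 t \<subseteq> ball (0::complex) R" using t by auto
  have "((\<lambda>u. F u / (u-0) ^ Suc n) has_contour_integral
          ((2 * pi * \<i>) / (fact n) * (deriv ^^ n) F 0)) (circlepath 0 t)"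
    using F sub t by (intro Cauchy_has_contour_integral_higher_derivative_circlepath)
       (auto intro: holomorphic_on_imp_continuous_on holomorphic_on_subset)
  then have "((\<lambda>x. F (0 + t * cis x) / (0 + t * cis x - 0) ^ Suc n * t * \<i> * cis x) has_integral
      ((2 * pi * \<i>) * taylor_coeff F n)) {0..2*pi}"
    unfolding circlepath_def by (subst (asm) has_contour_integral_part_circlepath_iff)
      (auto simp: taylor_coeff_eq)
  then have I: "((\<lambda>x. t ^ n / \<i> * (F (0 + t * cis x) / (0 + t * cis x - 0) ^ Suc n * t * \<i> * cis x))
      has_integral t ^ n / \<i> * ((2 * pi * \<i>) * taylor_coeff F n)) {0..2*pi}"
    by (rule has_integral_mult_right)
  have cancel: "a ^ n / \<i> * (u / (0 + a * b - 0) ^ Suc n * a * \<i> * b) = u * (1 / b ^ n)"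
    if "a \<noteq> 0" "b \<noteq> 0" for a b u :: complex
    using that by (simp add: power_mult_distrib mult_ac)
  have "(\<lambda>x. t ^ n / \<i> * (F (0 + t * cis x) / (0 + t * cis x - 0) ^ Suc n * t * \<i> * cis x))
           = (\<lambda>x::real. F (t * cis x) * cis (- (n * x)))"
  proof
    fix x :: real
    have "cis (- (n * x)) = 1 / cis x ^ n"
      by (simp add: Complex.DeMoivre cis_inverse flip: inverse_eq_divide)
    then show "t ^ n / \<i> * (F (0 + t * cis x) / (0 + t * cis x - 0) ^ Suc n * t * \<i> * cis x)
           = F (t * cis x) * cis (- (n * x))"
      using cancel[of "of_real t" "cis x" "F (t * cis x)"] t by (simp only: of_real_power add_0) simp
  qed
  moreover have "t ^ n / \<i> * ((2 * pi * \<i>) * taylor_coeff F n) = 2 * pi * t ^ n * taylor_coeff F n"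
    by (simp add: mult_ac)
  ultimately show ?thesis using I by (simp only:)
qed

corollary circle_mean_value:
  fixes F :: "complex \<Rightarrow> complex" and t :: real
  assumes "F holomorphic_on ball 0 R" and "0 < t" "t < R"
  shows "((\<lambda>x. F (t * cis x)) has_integral 2 * pi * F 0) {0..2*pi}"
  using circle_coeff_integral[OF assms, of 0] by (simp add: taylor_coeff_eq)

text \<open>Only sines are needed on the boundary: \<open>f(z) z\<^sup>n\<close> vanishes at the origin, so the mean of
\<open>f(t e\<^sup>i\<^sup>x) e\<^sup>i\<^sup>n\<^sup>x\<close> is zero, and subtracting it from the Cauchy formula for the \<open>n\<close>-th coefficient
turns the exponential into a sine.\<close>

lemma sine_coeff_integral:
  fixes f :: "complex \<Rightarrow> complex"
  assumes F: "f holomorphic_on \<D>" and "f 0 = 0" and t: "0 < t" "t < 1" and re: "taylor_coeff f n \<in> \<real>"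
  shows "((\<lambda>x. Im (f (t * cis x)) * sin (n * x)) has_integral
           pi * t ^ n * Re (taylor_coeff f n)) {0..2*pi}"
proof -
  have 1: "((\<lambda>x. f (t * cis x) * cis (- (of_nat n * x))) has_integral
           2 * pi * t ^ n * taylor_coeff f n) {0..2*pi}"
    using circle_coeff_integral F t by blast
  have "(\<lambda>z. f z * z ^ n) holomorphic_on ball 0 1" using F by (intro holomorphic_intros)
  from circle_mean_value[OF this t]
  have "((\<lambda>x. f (t * cis x) * (t * cis x)^n) has_integral 0) {0..2*pi}"
    using \<open>f 0 = 0\<close> by simp
  from has_integral_mult_right[OF this, of "1 / t ^ n"]
  have 2: "((\<lambda>x. f (t * cis x) * cis (n * x)) has_integral 0) {0..2*pi}"
    using t by (simp add: power_mult_distrib Complex.DeMoivre field_simps)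
  have "((\<lambda>x. (f (t * cis x) * cis (n * x) - f (t * cis x) * cis (- (of_nat n * x))) * (1 / (2 * \<i>)))
     has_integral (0 - 2 * pi * t ^ n * taylor_coeff f n) * (1 / (2 * \<i>))) {0..2*pi}"
    by (intro has_integral_mult_left has_integral_diff 1 2)
  also have "(\<lambda>x::real. (f (t * cis x) * cis (n * x) - f (t * cis x) * cis (- (of_nat n * x))) * (1 / (2 * \<i>)))
     = (\<lambda>x::real. f (t * cis x) * of_real (sin (n * x)))"
  proof
    fix x :: real
    have "cis (n * x) - cis (- (n * x)) = 2 * \<i> * of_real (sin (n * x))"
      by (simp add: complex_eq_iff)
    then show "(f (t * cis x) * cis (n * x) - f (t * cis x) * cis (- (n * x))) * (1 / (2 * \<i>))
        = f (t * cis x) * of_real (sin (n * x))"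
      unfolding right_diff_distrib[symmetric] by (simp only:) (simp add: complex_eq_iff)
  qed
  finally have "((Im \<circ> (\<lambda>x. f (t * cis x) * of_real (sin (n * x)))) has_integral
     Im ((0 - 2 * pi * t ^ n * taylor_coeff f n) * (1 / (2 * \<i>)))) {0..2*pi}"
    by (rule has_integral_linear[OF _ bounded_linear_Im])
  moreover obtain c where c: "taylor_coeff f n = of_real c" using re by (auto elim: Reals_cases)
  have "(0 - 2 * pi * t ^ n * taylor_coeff f n) * (1 / (2 * \<i>)) = \<i> * of_real (pi * t ^ n * c)"
    unfolding c by (simp add: complex_eq_iff Re_divide Im_divide)
  then have "Im ((0 - 2 * pi * t ^ n * taylor_coeff f n) * (1 / (2 * \<i>))) = pi * t ^ n * Re (taylor_coeff f n)"
    unfolding c by simp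
  ultimately show ?thesis by (simp add: o_def mult.assoc)
qed

lemma class_S_realD:
  assumes "f \<in> class_S_real"
  shows "f holomorphic_on \<D>" "f 0 = 0" "taylor_coeff f 0 = 0" "taylor_coeff f (Suc 0) = 1" "deriv f 0 = 1" "inj_on f \<D>"
    "taylor_coeff f n \<in> \<real>"
  using assms by (auto simp: class_S_real_def class_A_def analytic_imp_holomorphic taylor_coeff_eq)

definition real_coeff :: "(complex \<Rightarrow> complex) \<Rightarrow> nat \<Rightarrow> real" where
  "real_coeff f n = Re (taylor_coeff f n)"

lemma class_S_real_coeff:
  assumes "f \<in> class_S_real"
  shows "taylor_coeff f n = of_real (real_coeff f n)"
  using class_S_realD(7)[OF assms, of n] by (simp add: real_coeff_def)

lemma class_S_real_cnj:
  assumes f: "f \<in> class_S_real" and z: "z \<in> \<D>"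
  shows "f (cnj z) = cnj (f z)"
proof -
  have s: "(\<lambda>n. taylor_coeff f n * z ^ n) sums f z" if "z \<in> \<D>" for z
    using holomorphic_power_series[of f 0 1 z] that class_S_realD(1)[OF f] by (simp add: taylor_coeff_eq)
  have "(\<lambda>n. cnj (taylor_coeff f n * z ^ n)) sums cnj (f z)"
    using s[OF z] by (simp only: sums_cnj)
  moreover have "(\<lambda>n. taylor_coeff f n * cnj z ^ n) sums f (cnj z)"
    using z by (intro s) auto
  moreover have "cnj (taylor_coeff f n) = taylor_coeff f n" for n
    using class_S_realD(7)[OF f, of n] by (simp add: Reals_cnj_iff)
  ultimately show ?thesis by (simp add: sums_iff)
qed

text \<open>Real coefficients make \<open>f\<close> commute with conjugation, so a non-real point with a real value would
share that value with its conjugate. Hence \<open>Im f\<close> has no zero on the upper half disc, which is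
connected, and close to the origin its sign is that of \<open>Im z\<close>.\<close>

lemma class_S_real_typically_real:
  assumes f: "f \<in> class_S_real" and z: "z \<in> \<D>" "Im z > 0"
  shows "Im (f z) > 0"
proof -
  note D = class_S_realD[OF f]
  have nz: "Im (f w) \<noteq> 0" if "w \<in> \<D>" "Im w > 0" for w
  proof
    assume "Im (f w) = 0"
    then have "f (cnj w) = f w"
      using class_S_real_cnj[OF f that(1)] by (simp add: complex_eq_iff)
    moreover have "cnj w \<in> \<D>" using that by simp
    ultimately have "cnj w = w" using D(6) that by (auto dest: inj_onD)
    then show False using that by (simp add: complex_eq_iff)
  qed
  define U where "U = \<D> \<inter> {w. Im w > 0}"
  have "convex U" unfolding U_def by (intro convex_Int convex_ball convex_halfspace_Im_gt)
  then have conn: "connected ((\<lambda>w. Im (f w)) ` U)"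
    using D(1) by (intro connected_continuous_image convex_connected continuous_intros)
       (auto simp: U_def intro: holomorphic_on_imp_continuous_on holomorphic_on_subset)
  \<comment> \<open>The sign is read off on the imaginary axis near the origin, where \<open>f(iy)/(iy)\<close> tends to 1.\<close>
  have "(f has_field_derivative 1) (at 0)"
    using D(1,5) by (metis centre_in_ball holomorphic_derivI open_ball zero_less_one)
  then have "((\<lambda>w. f w / w) \<longlongrightarrow> 1) (at 0)" by (simp add: has_field_derivative_iff D(2))
  moreover have "filterlim (\<lambda>y. \<i> * of_real y) (at 0) (at_right (0::real))"
    unfolding filterlim_at by (auto intro!: tendsto_eq_intros simp: eventually_at_filter)
  ultimately have "((\<lambda>y. f (\<i> * of_real y) / (\<i> * of_real y)) \<longlongrightarrow> 1) (at_right (0::real))"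
    by (rule filterlim_compose)
  then have "((\<lambda>y. Re (f (\<i> * of_real y) / (\<i> * of_real y))) \<longlongrightarrow> 1) (at_right (0::real))"
    using tendsto_Re by fastforce
  then have "\<forall>\<^sub>F y in at_right (0::real). Re (f (\<i> * of_real y) / (\<i> * of_real y)) > 0"
    by (rule order_tendstoD) simp
  moreover have "\<forall>\<^sub>F y in at_right (0::real). y \<in> {0<..<1}" 
    by (rule eventually_at_right_real) simp
  ultimately have "\<forall>\<^sub>F y in at_right (0::real). Re (f (\<i> * of_real y) / (\<i> * of_real y)) > 0 \<and> y \<in> {0<..<1}"
    by eventually_elim auto
  then obtain y :: real where y: "Re (f (\<i> * of_real y) / (\<i> * of_real y)) > 0" "0 < y" "y < 1"
    by (auto dest: eventually_happens)
  have "Re (f (\<i> * of_real y) / (\<i> * of_real y)) = Im (f (\<i> * of_real y)) / y"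
    using y by (simp add: Re_divide power2_eq_square field_simps)
  then have pos: "Im (f (\<i> * of_real y)) > 0" using y by (simp add: zero_less_divide_iff)
  have inU: "\<i> * of_real y \<in> U" "z \<in> U" using y z by (auto simp: U_def norm_mult)
  show ?thesis
  proof (rule ccontr)
    assume "\<not> ?thesis"
    then have "0 \<in> (\<lambda>w. Im (f w)) ` U"
      using conn inU pos unfolding connected_iff_interval by (meson image_eqI less_imp_le not_le)
    then show False using nz by (auto simp: U_def)
  qed
qed

lemma class_S_real_typically_real_mult:
  assumes f: "f \<in> class_S_real" and z: "z \<in> \<D>"
  shows "Im (f z) * Im z \<ge> 0"
proof (cases "Im z" "0::real" rule: linorder_cases)
  case less
  have "Im (f (cnj z)) > 0"
    using less z by (intro class_S_real_typically_real[OF f]) auto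
  then show ?thesis using less class_S_real_cnj[OF f z] by (simp add: mult_nonpos_nonpos)
next
  case greater
  then show ?thesis using class_S_real_typically_real[OF f z] by simp
qed auto

text \<open>For a probability weight with cosine moments \<open>p k / 2\<close>, the number \<open>p k\<close> is exactly the constant
\<open>c\<close> that makes the mean of \<open>\<bar>c - e\<^sup>i\<^sup>k\<^sup>x\<bar>\<^sup>2 = c\<^sup>2 - 2 c cos kx + 1\<close> equal to 1. The combination
\<open>c cos lx - cos (k+l)x\<close> is the real part of \<open>e\<^sup>i\<^sup>l\<^sup>x (c - e\<^sup>i\<^sup>k\<^sup>x)\<close>, so its mean is at most the
mean of \<open>\<bar>c - e\<^sup>i\<^sup>k\<^sup>x\<bar>\<close>, hence at most 1.\<close>

lemma livingston_inequality_weight: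
  fixes w :: "real \<Rightarrow> real" and p :: "nat \<Rightarrow> real"
  assumes nn: "\<And>x. x \<in> S \<Longrightarrow> w x \<ge> 0" and mass: "(w has_integral 1) S"
    and p: "\<And>k. k \<ge> 1 \<Longrightarrow> ((\<lambda>x. w x * cos (k * x)) has_integral p k / 2) S"
    and kl: "k \<ge> 1" "l \<ge> 1"
  shows "\<bar>p k * p l - p (k + l)\<bar> \<le> 2" "\<bar>p k\<bar> \<le> 2"
proof -
  have pt: "\<bar>c * cos (l * x) - cos ((k + l) * x)\<bar> \<le> (2 + c\<^sup>2 - 2 * c * cos (k * x)) / 2" for c x :: real
  proof -
    let ?u = "of_real c - cis (k * x)"
    have "c * cos (l * x) - cos ((k + l) * x) = Re (cis (l * x) * ?u)"
      by (simp add: algebra_simps cos_add)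
    also have "\<bar>\<dots>\<bar> \<le> cmod (cis (l * x) * ?u)" by (rule abs_Re_le_cmod)
    also have "\<dots> = cmod ?u" by (simp add: norm_mult)
    also have "\<dots> \<le> (1 + (cmod ?u)\<^sup>2) / 2"
      using zero_le_power2[of "cmod ?u - 1"] by (simp add: power2_eq_square algebra_simps)
    also have "(cmod ?u)\<^sup>2 = (c - cos (k*x))\<^sup>2 + (sin (k*x))\<^sup>2" by (simp add: cmod_power2)
    also have "\<dots> = c\<^sup>2 - 2 * c * cos (k * x) + 1"
      by (simp add: sin_squared_eq power2_diff algebra_simps)
    finally show ?thesis by simp
  qed
  let ?c = "p k"
  have R: "((\<lambda>x. (2 + ?c\<^sup>2) / 2 * w x - ?c * (w x * cos (k * x))) has_integral 
     ((2 + ?c\<^sup>2) / 2 * 1 - ?c * (?c / 2))) S"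
    by (intro has_integral_diff has_integral_mult_right mass p kl)
  have L: "((\<lambda>x. ?c * (w x * cos (l * x)) - w x * cos ((k + l) * x)) has_integral
     (?c * (p l / 2) - p (k + l) / 2)) S"
    using p[of "k + l"] kl by (intro has_integral_diff has_integral_mult_right p) auto
  have le: "norm (?c * (w x * cos (l * x)) - w x * cos ((k + l) * x))
     \<le> (2 + ?c\<^sup>2) / 2 * w x - ?c * (w x * cos (k * x))" if "x \<in> S" for x :: real
  proof -
    have "norm (?c * (w x * cos (l * x)) - w x * cos ((k + l) * x))
      = w x * \<bar>?c * cos (l * x) - cos ((k + l) * x)\<bar>"
    proof -
      have "?c * (w x * cos (l * x)) - w x * cos ((k + l) * x) = w x * (?c * cos (l * x) - cos ((k + l) * x))"
        by (simp add: algebra_simps)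
      then show ?thesis using nn[OF that] by (simp add: abs_mult)
    qed
    also have "\<dots> \<le> w x * ((2 + ?c\<^sup>2 - 2 * ?c * cos (k * x)) / 2)"
      by (intro mult_left_mono pt nn that)
    finally show ?thesis by (simp add: algebra_simps)
  qed
  have "norm (?c * (p l / 2) - p (k + l) / 2) \<le> ((2 + ?c\<^sup>2) / 2 * 1 - ?c * (?c / 2))"
    using integral_norm_bound_integral[OF has_integral_integrable[OF L] has_integral_integrable[OF R] le]
    unfolding integral_unique[OF L] integral_unique[OF R] .
  then show "\<bar>p k * p l - p (k + l)\<bar> \<le> 2" by (simp add: power2_eq_square algebra_simps)
  have le1: "norm (w x * cos (k * x)) \<le> w x" if "x \<in> S" for x :: real
    using nn[OF that] by (simp add: abs_mult mult_left_le)
  have "norm (p k / 2) \<le> 1"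
    using integral_norm_bound_integral[OF has_integral_integrable[OF p[OF kl(1)]] has_integral_integrable[OF mass]]
      le1 by (simp add: integral_unique[OF p[OF kl(1)]] integral_unique[OF mass])
  then show "\<bar>p k\<bar> \<le> 2" by simp
qed

text \<open>On the circle of radius \<open>t\<close> the weight \<open>Im f(t e\<^sup>i\<^sup>x) sin x / (\<pi> t)\<close> is non-negative, because
\<open>Im f\<close> and \<open>Im z\<close> have the same sign. Since \<open>2 sin x cos kx = sin (k+1)x - sin (k-1)x\<close>, its
cosine moments are half the differences of the coefficients of \<open>f(tz)/t\<close>. Letting \<open>t\<close> tend to 1
removes the radius.\<close>

lemma class_S_real_livingston_inequality:
  assumes f: "f \<in> class_S_real" and kl: "k \<ge> 1" "l \<ge> 1"
  defines "p \<equiv> cos_coeff (real_coeff f)"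
  shows "\<bar>p k * p l - p (k + l)\<bar> \<le> 2" "\<bar>p k\<bar> \<le> 2"
proof -
  note D = class_S_realD[OF f]
  define q where "q = (\<lambda>t. cos_coeff (\<lambda>n. real_coeff f n * t ^ n / t))"
  have ev: "\<bar>q t k * q t l - q t (k + l)\<bar> \<le> 2 \<and> \<bar>q t k\<bar> \<le> 2" if t: "0 < t" "t < 1" for t
  proof -
    let ?v = "\<lambda>x. Im (f (t * cis x))"
    let ?w = "\<lambda>x. ?v x * sin x / (pi * t)"
    have s: "((\<lambda>x. ?v x * sin (n * x)) has_integral pi * t ^ n * real_coeff f n) {0..2*pi}" for n
      using sine_coeff_integral[OF D(1,2) t D(7)] by (simp add: real_coeff_def)
    have w: "((\<lambda>x. ?w x * cos (k * x)) has_integral q t k / 2) {0..2*pi}" if "k \<ge> 1" for k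
    proof -
      have "((\<lambda>x. (?v x * sin (real (k+1) * x) - ?v x * sin (real (k-1) * x)) / (2 * pi * t)) has_integral
        (pi * t ^ (k+1) * real_coeff f (k+1) - pi * t ^ (k-1) * real_coeff f (k-1)) / (2 * pi * t)) {0..2*pi}"
        by (intro has_integral_divide has_integral_diff s)
      moreover have "(?v x * sin (real (k+1) * x) - ?v x * sin (real (k-1) * x)) / (2 * pi * t)
         = ?w x * cos (k * x)" for x :: real
        using that t by (simp add: field_simps of_nat_diff sin_add sin_diff)
      moreover have "(pi * t ^ (k+1) * real_coeff f (k+1) - pi * t ^ (k-1) * real_coeff f (k-1)) / (2 * pi * t)
         = q t k / 2"
        using t by (simp add: q_def cos_coeff_def field_simps)
      ultimately show ?thesis by (simp only:)
    qed
    have m: "(?w has_integral 1) {0..2*pi}"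
      using has_integral_divide[OF s[of 1], of "pi * t"] D(4) t by (simp add: real_coeff_def)
    have nn: "?w x \<ge> 0" for x
    proof -
      have "0 \<le> ?v x * Im (t * cis x)"
        using t by (intro class_S_real_typically_real_mult[OF f]) (simp add: norm_mult)
      then have "0 \<le> t * (?v x * sin x)" by (simp add: mult_ac)
      then show ?thesis using t by (simp add: zero_le_mult_iff)
    qed
    show ?thesis using livingston_inequality_weight[of "{0..2*pi}" ?w "q t", OF nn m w kl] by auto
  qed
  have lim: "((\<lambda>t. q t j) \<longlongrightarrow> p j) (at_left 1)" for j
  proof -
    let ?c = "real_coeff f"
    have "((\<lambda>t. ?c (j+1) * t^(j+1) / t - ?c (j-1) * t^(j-1) / t) \<longlongrightarrow>
        ?c (j+1) * 1^(j+1) / 1 - ?c (j-1) * 1^(j-1) / 1) (at_left 1)"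
      by (intro tendsto_intros) auto
    then show ?thesis by (simp only: q_def p_def cos_coeff_def power_one mult_1_right div_by_1)
  qed
  have ev': "\<forall>\<^sub>F t in at_left 1. \<bar>q t k * q t l - q t (k + l)\<bar> \<le> 2 \<and> \<bar>q t k\<bar> \<le> 2"
    by (rule eventually_mono[OF eventually_at_left_real[of 0 1]]) (use ev in auto)
  have "((\<lambda>t. \<bar>q t k * q t l - q t (k + l)\<bar>) \<longlongrightarrow> \<bar>p k * p l - p (k + l)\<bar>) (at_left 1)"
    by (intro tendsto_intros lim)
  then show "\<bar>p k * p l - p (k + l)\<bar> \<le> 2"
    by (rule tendsto_upperbound) (use ev' in \<open>auto elim: eventually_mono\<close>)
  have "((\<lambda>t. \<bar>q t k\<bar>) \<longlongrightarrow> \<bar>p k\<bar>) (at_left 1)"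
    by (intro tendsto_intros lim)
  then show "\<bar>p k\<bar> \<le> 2"
    by (rule tendsto_upperbound) (use ev' in \<open>auto elim: eventually_mono\<close>)
qed

section \<open>The area of a conformal image\<close>

text \<open>Jacobians are available on \<open>real^2\<close> and iterated integrals on \<open>real \<times> real\<close>; this is the passage
from one to the other.\<close>

definition vec2 :: "real \<Rightarrow> real \<Rightarrow> real^2" where
  "vec2 x y = x *\<^sub>R axis 1 1 + y *\<^sub>R axis 2 1"

lemma vec2_nth [simp]: "vec2 x y $ 1 = x" "vec2 x y $ 2 = y"
  by (simp_all add: vec2_def axis_def)

lemma vec2_eta: "vec2 (v $ 1) (v $ 2) = v"
  by (simp add: vec_eq_iff forall_2)

lemma has_integral_vec2_iterated:
  fixes g :: "real \<times> real \<Rightarrow> real"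
  assumes "continuous_on (cbox (a, c) (b, d)) g"
  shows "((\<lambda>v. g (v $ 1, v $ 2)) has_integral
           integral {a..b} (\<lambda>s. integral {c..d} (\<lambda>x. g (s, x)))) (cbox (vec2 a c) (vec2 b d))"
proof -
  have "(g has_integral integral (cbox (a, c) (b, d)) g) (cbox (a, c) (b, d))"
    using assms by (intro integrable_integral integrable_continuous)
  also have "integral (cbox (a, c) (b, d)) g = integral {a..b} (\<lambda>s. integral {c..d} (\<lambda>x. g (s, x)))"
    using integral_prod_continuous[OF assms] by (simp add: cbox_interval)
  finally have I: "(g has_integral integral {a..b} (\<lambda>s. integral {c..d} (\<lambda>x. g (s, x)))) (cbox (a, c) (b, d))" .
  have im1: "(\<lambda>v. (v $ 1, v $ 2)) ` cbox u v = cbox (u $ 1, u $ 2) (v $ 1, v $ 2)" for u v :: "real^2"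
  proof -
    have "p \<in> (\<lambda>v. (v $ 1, v $ 2)) ` cbox u v" if "p \<in> cbox (u $ 1, u $ 2) (v $ 1, v $ 2)" for p
      using that by (intro image_eqI[of _ _ "vec2 (fst p) (snd p)"]) (auto simp: mem_box_cart forall_2 cbox_Pair_eq)
    then show ?thesis by (auto simp: mem_box_cart forall_2 cbox_Pair_eq)
  qed
  have im2: "(\<lambda>p. vec2 (fst p) (snd p)) ` cbox u v = cbox (vec2 (fst u) (snd u)) (vec2 (fst v) (snd v))" for u v
  proof -
    have "w \<in> (\<lambda>p. vec2 (fst p) (snd p)) ` cbox u v" if "w \<in> cbox (vec2 (fst u) (snd u)) (vec2 (fst v) (snd v))" for w
      using that by (intro image_eqI[of _ _ "(w $ 1, w $ 2)"])
        (cases u; cases v; auto simp: mem_box_cart forall_2 cbox_Pair_eq vec2_eta)+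
    then show ?thesis by (cases u; cases v; auto simp: mem_box_cart forall_2 cbox_Pair_eq)
  qed
  have "((\<lambda>v. g (v $ 1, v $ 2)) has_integral (1 / 1) *\<^sub>R
           integral {a..b} (\<lambda>s. integral {c..d} (\<lambda>x. g (s, x)))) ((\<lambda>p. vec2 (fst p) (snd p)) ` cbox (a, c) (b, d))"
  proof (rule has_integral_twiddle[OF _ _ _ _ _ _ _ I])
    show "measure lborel ((\<lambda>v. (v $ 1, v $ 2)) ` cbox u v) = 1 * measure lborel (cbox u v)" for u v :: "real^2"
    proof -
      have "cbox u v \<noteq> {} \<longleftrightarrow> u $ 1 \<le> v $ 1 \<and> u $ 2 \<le> v $ 2"
        by (simp add: interval_ne_empty_cart forall_2)
      then show ?thesis
        unfolding im1 content_Pair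
        by (auto simp: content_cbox_if_cart content_cbox_if prod_2 UNIV_2 simp flip: box_real)
    qed
  qed (auto simp: im1 im2 vec2_eta)
  then show ?thesis unfolding im2 by simp
qed

text \<open>The Jacobian of a holomorphic map is \<open>\<bar>H'\<bar>\<^sup>2\<close>. Scaling the two axes by \<open>1/A\<close> and \<open>1/B\<close> turns the
elliptic bound on the image into a disc of radius \<open>K\<close>, so the area of the image is compared with
that of a disc, and the area of an ellipse is not needed.\<close>

lemma conformal_area_bound:
  fixes H H' :: "complex \<Rightarrow> complex"
  assumes der: "\<And>z. z \<in> box (Complex a c) (Complex b d) \<Longrightarrow> (H has_field_derivative H' z) (at z)"
    and cont: "continuous_on (cbox (Complex a c) (Complex b d)) H'"
    and inj: "inj_on H (box (Complex a c) (Complex b d))"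
    and AB: "A > 0" "B > 0" "K \<ge> 0"
    and bound: "\<And>z. z \<in> box (Complex a c) (Complex b d) \<Longrightarrow> (Re (H z) / A)\<^sup>2 + (Im (H z) / B)\<^sup>2 < K\<^sup>2"
  shows "integral {a..b} (\<lambda>s. integral {c..d} (\<lambda>x. (cmod (H' (Complex s x)))\<^sup>2)) \<le> A * B * pi * K\<^sup>2"
proof -
  let ?Z = "\<lambda>v::real^2. Complex (v $ 1) (v $ 2)"
  let ?S = "box (vec2 a c) (vec2 b d)"
  define F where "F = (\<lambda>v. vec2 (Re (H (?Z v)) / A) (Im (H (?Z v)) / B))"
  define F' where "F' = (\<lambda>v u. vec2 (Re (H' (?Z v) * ?Z u) / A) (Im (H' (?Z v) * ?Z u) / B))"
  define J where "J = integral {a..b} (\<lambda>s. integral {c..d} (\<lambda>x. (cmod (H' (Complex s x)))\<^sup>2))"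
  have Z: "?Z v \<in> box (Complex a c) (Complex b d)" if "v \<in> ?S" for v
    using that by (auto simp: mem_box_cart forall_2 in_box_complex_iff)
  have Zlin: "bounded_linear ?Z"
    unfolding Complex_eq
    by (intro bounded_linear_intros bounded_linear_compose[OF bounded_linear_of_real] bounded_linear_vec_nth) 
  have derF: "(F has_derivative F' v) (at v within ?S)" if "v \<in> ?S" for v
  proof -
    have "((\<lambda>v. H (?Z v)) has_derivative (\<lambda>u. H' (?Z v) * ?Z u)) (at v within ?S)"
      using der[OF Z[OF that]] unfolding has_field_derivative_def
      by (rule has_derivative_compose[OF bounded_linear_imp_has_derivative[OF Zlin]])
    then show ?thesis unfolding F_def F'_def vec2_def
      using AB by (auto intro!: derivative_eq_intros)
  qed
  have injF: "inj_on F ?S"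
  proof (rule inj_onI)
    fix u v assume *: "u \<in> ?S" "v \<in> ?S" "F u = F v"
    then have "F u $ 1 = F v $ 1" "F u $ 2 = F v $ 2" by auto
    then have "H (?Z u) = H (?Z v)" using AB by (simp add: F_def complex_eq_iff)
    then have "?Z u = ?Z v" using inj Z * by (auto dest: inj_onD)
    then show "u = v" by (simp add: vec_eq_iff forall_2)
  qed
  have det: "\<bar>det (matrix (F' v))\<bar> = (cmod (H' (?Z v)))\<^sup>2 / (A * B)" for v
    using AB by (simp add: det_2 matrix_def F'_def axis_def cmod_power2 field_simps)
      (simp add: power2_eq_square)
  have "continuous_on (cbox (a, c) (b, d)) (\<lambda>p. (cmod (H' (Complex (fst p) (snd p))))\<^sup>2)"
  proof -
    have "continuous_on (cbox (a, c) (b, d)) (\<lambda>p. Complex (fst p) (snd p))"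
      unfolding Complex_eq by (intro continuous_intros)
    then have "continuous_on (cbox (a, c) (b, d)) (\<lambda>p. H' (Complex (fst p) (snd p)))"
      by (rule continuous_on_compose2[OF cont]) (auto simp: in_cbox_complex_iff cbox_Pair_eq)
    then show ?thesis by (intro continuous_intros)
  qed
  from has_integral_vec2_iterated[OF this]
  have "((\<lambda>v. (cmod (H' (?Z v)))\<^sup>2) has_integral J) (cbox (vec2 a c) (vec2 b d))"
    by (simp add: J_def)
  then have "((\<lambda>v. (cmod (H' (?Z v)))\<^sup>2) has_integral J) ?S"
    by (simp add: has_integral_open_interval)
  then have "((\<lambda>v. \<bar>det (matrix (F' v))\<bar>) has_integral J / (A * B)) ?S"
    unfolding det by (rule has_integral_divide)
  with has_measure_differentiable_image[OF _ derF injF]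
  have m: "F ` ?S \<in> lmeasurable" "measure lebesgue (F ` ?S) = J / (A * B)"
    by auto
  have "F ` ?S \<subseteq> ball 0 K"
  proof
    fix w assume "w \<in> F ` ?S"
    then obtain v where v: "v \<in> ?S" "w = F v" by auto
    have "(norm w)\<^sup>2 = (Re (H (?Z v)) / A)\<^sup>2 + (Im (H (?Z v)) / B)\<^sup>2"
      by (simp add: v F_def norm_vec_def L2_set_def sum_2)
    also have "\<dots> < K\<^sup>2" using bound Z v by blast
    finally show "w \<in> ball 0 K" using AB(3) by (simp add: power2_less_imp_less)
  qed
  then have "measure lebesgue (F ` ?S) \<le> measure lebesgue (ball (0::real^2) K)"
    using m by (intro measure_mono_fmeasurable) auto
  also have "\<dots> = K\<^sup>2 * pi" using circle_area[OF AB(3), of 0] by simp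
  finally have "J / (A * B) \<le> K\<^sup>2 * pi" using m by simp
  then show ?thesis using AB by (simp add: J_def field_simps)
qed

section \<open>The area theorem for the first Laurent coefficient\<close>

text \<open>Bessel's inequality on a circle: writing the integrand as \<open>\<bar>q + m\<bar>\<^sup>2\<close> with \<open>q = -1/z + bz\<close> and
\<open>m = z\<^sup>2 e(z)\<close>, drop \<open>\<bar>m\<bar>\<^sup>2\<close>. On \<open>\<bar>z\<bar> = t\<close> the conjugate of \<open>z\<close> is \<open>t\<^sup>2/z\<close>, so everything else
in the expansion, except the constant \<open>1/t\<^sup>2 + b\<^sup>2t\<^sup>2\<close>, is the real part of a holomorphic function
vanishing at the origin and has mean zero.\<close>

lemma circle_energy_lower_bound:
  fixes e :: "complex \<Rightarrow> complex" and b t :: real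
  assumes e: "e holomorphic_on ball 0 1" and t: "0 < t" "t < 1"
  shows "2 * pi * (1 / t\<^sup>2 + b\<^sup>2 * t\<^sup>2) \<le>
    integral {0..2*pi} (\<lambda>x. (cmod (- 1 / (t * cis x) + b * (t * cis x) + (t * cis x)\<^sup>2 * e (t * cis x)))\<^sup>2)"
proof -
  define D where "D = (\<lambda>z::complex. - 1 / z + b * z + z\<^sup>2 * e z)"
  \<comment> \<open>The holomorphic function whose real part is \<open>\<bar>q\<bar>\<^sup>2 + 2 Re (m cnj q)\<close> up to the constant.\<close>
  define P where "P = (\<lambda>z::complex. - 2 * b * z\<^sup>2 / t\<^sup>2 - 2 * z ^ 3 * e z / t\<^sup>2 + 2 * b * t\<^sup>2 * z * e z)"
  have P: "((\<lambda>x. P (t * cis x)) has_integral 2 * pi * P 0) {0..2*pi}"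
    unfolding P_def using t by (intro circle_mean_value[of _ 1] holomorphic_intros e) auto
  then have "((Re \<circ> (\<lambda>x. P (t * cis x))) has_integral Re (2 * pi * P 0)) {0..2*pi}"
    by (rule has_integral_linear[OF _ bounded_linear_Re])
  then have "((\<lambda>x. Re (P (t * cis x))) has_integral 0) {0..2*pi}"
    by (simp add: o_def P_def)
  from has_integral_add[OF has_integral_const_real[of "1 / t\<^sup>2 + b\<^sup>2 * t\<^sup>2" 0 "2*pi"] this]
  have L: "((\<lambda>x. (1 / t\<^sup>2 + b\<^sup>2 * t\<^sup>2) + Re (P (t * cis x))) has_integral
     2 * pi * (1 / t\<^sup>2 + b\<^sup>2 * t\<^sup>2)) {0..2*pi}" by simp
  have "continuous_on {0..2*pi} (\<lambda>x. (cmod (D (t * cis x)))\<^sup>2)"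
  proof -
    have "continuous_on {0..2*pi} (\<lambda>x. e (t * cis x))"
      by (rule continuous_on_compose2[OF holomorphic_on_imp_continuous_on[OF e]])
        (use t in \<open>auto intro!: continuous_intros simp: norm_mult\<close>)
    then show ?thesis unfolding D_def using t by (intro continuous_intros) auto
  qed
  then have R: "(\<lambda>x. (cmod (D (t * cis x)))\<^sup>2) integrable_on {0..2*pi}"
    by (rule integrable_continuous_real)
  have le: "(1 / t\<^sup>2 + b\<^sup>2 * t\<^sup>2) + Re (P (t * cis x)) \<le> (cmod (D (t * cis x)))\<^sup>2" for x
  proof -
    define z where "z = t * cis x"
    define q where "q = - 1 / z + b * z"
    define m where "m = z\<^sup>2 * e z"
    have z: "z \<noteq> 0" and cz: "cnj z = of_real (t\<^sup>2) / z"
      using t by (auto simp: z_def cis_cnj cis_mult power2_eq_square field_simps)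
    have cq: "cnj q = - z / t\<^sup>2 + b * t\<^sup>2 / z"
      using z t by (simp add: q_def cz)
    have "Re (t\<^sup>2 / z\<^sup>2) = Re (cnj (t\<^sup>2 / z\<^sup>2))" by (simp only: cnj.sel)
    also have "cnj (t\<^sup>2 / z\<^sup>2) = z\<^sup>2 / t\<^sup>2"
      using z t by (simp add: cz field_simps power2_eq_square)
    finally have rz: "Re (t\<^sup>2 / z\<^sup>2) = Re (z\<^sup>2 / t\<^sup>2)" .
    have Re_mult_real: "Re (of_real c * w) = c * Re w" for c :: real and w by simp
    have "(cmod q)\<^sup>2 = Re (q * cnj q)" by (simp add: complex_mult_cnj cmod_power2)
    also have "q * cnj q = of_real (1 / t\<^sup>2 + b\<^sup>2 * t\<^sup>2) - of_real b * (z\<^sup>2 / t\<^sup>2) - of_real b * (t\<^sup>2 / z\<^sup>2)"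
      unfolding cq unfolding q_def using z t by (simp add: field_simps power2_eq_square)
    also have "Re \<dots> = 1 / t\<^sup>2 + b\<^sup>2 * t\<^sup>2 - b * Re (z\<^sup>2 / t\<^sup>2) - b * Re (t\<^sup>2 / z\<^sup>2)"
      by (simp only: minus_complex.sel Re_complex_of_real Re_mult_real)
    also have "\<dots> = 1 / t\<^sup>2 + b\<^sup>2 * t\<^sup>2 + Re (- 2 * b * z\<^sup>2 / t\<^sup>2)"
    proof -
      have "Re (- 2 * b * z\<^sup>2 / t\<^sup>2) = Re (of_real (- 2 * b) * (z\<^sup>2 / t\<^sup>2))" by simp
      also have "\<dots> = - 2 * b * Re (z\<^sup>2 / t\<^sup>2)" by (rule Re_mult_real)
      finally show ?thesis using rz by simp
    qed
    finally have q2: "(cmod q)\<^sup>2 = 1 / t\<^sup>2 + b\<^sup>2 * t\<^sup>2 + Re (- 2 * b * z\<^sup>2 / t\<^sup>2)" .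
    have mq: "2 * (m * cnj q) = - 2 * z ^ 3 * e z / t\<^sup>2 + 2 * b * t\<^sup>2 * z * e z"
      unfolding cq m_def using z t by (simp add: field_simps power2_eq_square power3_eq_cube)
    have "(cmod (q + m))\<^sup>2 = (cmod q)\<^sup>2 + Re (2 * (m * cnj q)) + (cmod m)\<^sup>2"
      unfolding cmod_power2 by (simp add: power2_eq_square algebra_simps)
    also have "\<dots> \<ge> (cmod q)\<^sup>2 + Re (2 * (m * cnj q))" by simp
    also have "(cmod q)\<^sup>2 + Re (2 * (m * cnj q)) = (1 / t\<^sup>2 + b\<^sup>2 * t\<^sup>2) + Re (P z)"
      unfolding q2 mq P_def by simp
    also have "q + m = D z" by (simp add: D_def q_def m_def)
    finally show ?thesis by (simp add: z_def)
  qed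
  have "integral {0..2*pi} (\<lambda>x. (1 / t\<^sup>2 + b\<^sup>2 * t\<^sup>2) + Re (P (t * cis x)))
      \<le> integral {0..2*pi} (\<lambda>x. (cmod (D (t * cis x)))\<^sup>2)"
    by (intro integral_le R le has_integral_integrable[OF L])
  then show ?thesis unfolding integral_unique[OF L] D_def .
qed

text \<open>The map \<open>1/z + bz\<close> sends the circle of radius \<open>r\<close> to the ellipse with semi-axes \<open>A\<close> and \<open>B\<close>, and
larger circles to ellipses inside it: at radius \<open>t\<close> they are smaller by a factor of at most
\<open>1 - (t - r)/4\<close>. Relative to semi-axes of order \<open>1/r\<close> the perturbation \<open>w\<close> has size at most
\<open>2 C r t\<^sup>2\<close>, which exceeds \<open>2 C r\<^sup>3\<close> by no more than this gain. So the whole image of \<open>r < \<bar>z\<bar> < 1\<close> stays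
in the ellipse blown up by \<open>1 + O(r\<^sup>3)\<close>. The extra \<open>r\<^sup>3\<close> in the bound makes it strict.\<close>

lemma perturbed_ellipse_bound:
  fixes b C r t x :: real and w :: complex
  assumes r: "0 < r" "r < t" "t < 1" and small: "\<bar>b\<bar> * r \<le> 1 / 8" "C * r \<le> 1 / 16"
    and w: "cmod w \<le> C * t\<^sup>2"
  defines "A \<equiv> 1 / r + b * r" and "B \<equiv> 1 / r - b * r"
  defines "g \<equiv> 1 / (t * cis x) + b * (t * cis x) + w"
  shows "(Re g / A)\<^sup>2 + (Im g / B)\<^sup>2 < (1 + (2 * C + 1) * r ^ 3)\<^sup>2"
proof -
  define U where "U = 1 - (t - r) / 4"
  have C: "C \<ge> 0" using w norm_ge_zero[of w] r by (smt (verit) mult_neg_pos zero_less_power)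
  \<comment> \<open>Both semi-axes at once: \<open>c = b\<close> gives the horizontal and \<open>c = -b\<close> the vertical one.\<close>
  have key: "1 / (2 * r) \<le> 1 / r + c * r \<and> \<bar>1 / t + c * t\<bar> / (1 / r + c * r) \<le> U" if c: "\<bar>c\<bar> = \<bar>b\<bar>" for c :: real
  proof -
    have cr: "\<bar>c * r\<bar> \<le> 1 / 8" using small c r by (simp add: abs_mult)
    have cr2: "\<bar>c * r * r\<bar> \<le> 1 / 8" using cr r mult_mono[of "\<bar>c * r\<bar>" "1/8" r 1] by (simp add: abs_mult)
    have lo: "1 / (2 * r) \<le> 1 / r + c * r" using cr2 r by (simp add: field_simps abs_le_iff)
    then have pos: "1 / r + c * r > 0" using r by (smt (verit) divide_pos_pos)
    have hi: "1 / r + c * r \<le> 2 / r" using cr2 r by (simp add: field_simps abs_le_iff)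
    have "1 / t + c * t \<le> U * (1 / r + c * r)"
    proof -
      have "1 / (2 * r) \<le> 1 / r - c" using cr r by (simp add: field_simps abs_le_iff)
      also have "1 / r - c \<le> 1 / (r * t) - c" using r by (simp add: field_simps)
      finally have "(t - r) * (1 / (2 * r)) \<le> (t - r) * (1 / (r * t) - c)" using r by (intro mult_left_mono) auto
      also have "(t - r) * (1 / (r * t) - c) = (1 / r + c * r) - (1 / t + c * t)"
        using r by (simp add: field_simps)
      finally have "1 / t + c * t \<le> (1 / r + c * r) - (t - r) * (1 / (2 * r))" by linarith
      also have "(t - r) * (1 / (2 * r)) = (t - r) / 4 * (2 / r)"
        using r by (simp add: field_simps)
      finally have "1 / t + c * t \<le> (1 / r + c * r) - (t - r) / 4 * (2 / r)" .
      also have "\<dots> \<le> (1 / r + c * r) - (t - r) / 4 * (1 / r + c * r)"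
        using hi r by (intro diff_left_mono mult_left_mono) auto
      finally show ?thesis by (simp add: U_def algebra_simps)
    qed
    moreover have "- (1 / t + c * t) \<le> U * (1 / r + c * r)"
    proof -
      have "- (1 / t + c * t) \<le> \<bar>c\<bar>" 
      proof -
        have "\<bar>c * t\<bar> \<le> \<bar>c\<bar>" using r by (simp add: abs_mult mult_left_le)
        moreover have "1 / t > 0" using r by simp
        ultimately show ?thesis by linarith
      qed
      also have "\<dots> \<le> 3 / 4 * (1 / (2 * r))" using cr r by (simp add: field_simps abs_mult)
      also have "\<dots> \<le> U * (1 / r + c * r)" using lo r by (intro mult_mono) (auto simp: U_def)
      finally show ?thesis .
    qed
    ultimately have "\<bar>1 / t + c * t\<bar> \<le> U * (1 / r + c * r)" by linarith
    then show ?thesis using lo pos by (simp add: pos_divide_le_eq)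
  qed
  have A: "1 / (2 * r) \<le> A" "\<bar>1 / t + b * t\<bar> / A \<le> U" using key[of b] by (auto simp: A_def)
  have B: "1 / (2 * r) \<le> B" "\<bar>1 / t - b * t\<bar> / B \<le> U" using key[of "- b"] by (auto simp: B_def)
  have AB: "A > 0" "B > 0" using A(1) B(1) r by (smt (verit) divide_pos_pos)+
  have U: "U \<ge> 0" using r by (simp add: U_def)
  \<comment> \<open>\<open>Q\<close> and \<open>E\<close> are the main part and the perturbation after scaling the axes by \<open>1/A\<close> and \<open>1/B\<close>.\<close>
  define Q where "Q = Complex ((1 / t + b * t) / A * cos x) (- ((1 / t - b * t) / B * sin x))"
  define E where "E = Complex (Re w / A) (Im w / B)"
  have "cmod Q \<le> U"
  proof (rule power2_le_imp_le[OF _ U])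
    have "(cmod Q)\<^sup>2 = (\<bar>1 / t + b * t\<bar> / A)\<^sup>2 * (cos x)\<^sup>2 + (\<bar>1 / t - b * t\<bar> / B)\<^sup>2 * (sin x)\<^sup>2"
      by (simp add: Q_def cmod_power2 power_mult_distrib power_divide)
    also have "\<dots> \<le> U\<^sup>2 * (cos x)\<^sup>2 + U\<^sup>2 * (sin x)\<^sup>2"
      using A B AB by (intro add_mono mult_right_mono power_mono) auto
    also have "\<dots> = U\<^sup>2" by (simp flip: distrib_left)
    finally show "(cmod Q)\<^sup>2 \<le> U\<^sup>2" .
  qed
  moreover have "cmod E \<le> 2 * r * (C * t\<^sup>2)"
  proof (rule power2_le_imp_le)
    have le: "1 / X \<le> 2 * r" if "1 / (2 * r) \<le> X" "X > 0" for X
      using that r by (simp add: field_simps)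
    have "(cmod E)\<^sup>2 = (1 / A)\<^sup>2 * (Re w)\<^sup>2 + (1 / B)\<^sup>2 * (Im w)\<^sup>2"
      by (simp add: E_def cmod_power2 power_divide)
    also have "\<dots> \<le> (2 * r)\<^sup>2 * (Re w)\<^sup>2 + (2 * r)\<^sup>2 * (Im w)\<^sup>2"
      using A B AB le by (intro add_mono mult_right_mono power_mono) auto
    also have "\<dots> = (2 * r)\<^sup>2 * (cmod w)\<^sup>2" by (simp add: cmod_power2 distrib_left)
    also have "\<dots> \<le> (2 * r)\<^sup>2 * (C * t\<^sup>2)\<^sup>2" using w by (intro mult_left_mono power_mono) auto
    finally show "(cmod E)\<^sup>2 \<le> (2 * r * (C * t\<^sup>2))\<^sup>2" by (simp add: power_mult_distrib)
  qed (use C r in auto)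
  ultimately have "cmod (Q + E) \<le> U + 2 * r * (C * t\<^sup>2)" by (rule norm_triangle_mono)
  also have "\<dots> < 1 + (2 * C + 1) * r ^ 3"
  proof -
    have "C * r * (t + r) \<le> 1 / 16 * 2" using small r C by (intro mult_mono) auto
    then have "(t - r) * (2 * (C * r * (t + r))) \<le> (t - r) * (1 / 4)" using r by (intro mult_left_mono) auto
    moreover have "2 * r * (C * t\<^sup>2) = 2 * C * r ^ 3 + (t - r) * (2 * (C * r * (t + r)))"
      by (simp add: power2_eq_square power3_eq_cube algebra_simps)
    moreover have "(2 * C + 1) * r ^ 3 = 2 * C * r ^ 3 + r ^ 3" by (simp add: algebra_simps)
    moreover have "r ^ 3 > 0" using r by simp
    ultimately show ?thesis unfolding U_def by linarith
  qed
  finally have "(cmod (Q + E))\<^sup>2 < (1 + (2 * C + 1) * r ^ 3)\<^sup>2" by (intro power_strict_mono) auto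
  moreover have "(cmod (Q + E))\<^sup>2 = (Re g / A)\<^sup>2 + (Im g / B)\<^sup>2"
  proof -
    define u v where "u = 1 / t + b * t" and "v = 1 / t - b * t"
    have "1 / (t * cis x) = of_real (1 / t) * cis (- x)" using r by (simp add: cis_mult field_simps)
    then have "g = of_real (1 / t) * cis (- x) + b * (t * cis x) + w" by (simp only: g_def)
    then have "Re g = u * cos x + Re w" "Im g = - (v * sin x) + Im w"
      by (simp_all add: u_def v_def distrib_right left_diff_distrib)
    moreover have "Q = Complex (u / A * cos x) (- (v / B * sin x))"
      by (simp add: Q_def u_def v_def)
    ultimately have "Re (Q + E) = Re g / A" "Im (Q + E) = Im g / B"
      by (simp_all add: E_def add_divide_distrib diff_divide_distrib)
    then show ?thesis by (simp only: cmod_power2 power_divide)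
  qed
  ultimately show ?thesis by simp
qed

text \<open>The part of Gronwall's area theorem that concerns the first coefficient. In the coordinate
\<open>log z\<close> the annulus \<open>r < \<bar>z\<bar> < \<rho>\<close> is a rectangle, so the area of its image is an iterated
integral, at least \<open>\<pi> (r\<^sup>-\<^sup>2 - \<rho>\<^sup>-\<^sup>2 + b\<^sup>2 (\<rho>\<^sup>2 - r\<^sup>2))\<close> by Bessel's inequality on each circle. By
injectivity the image lies in the ellipse above without overlaps, so its area is at most
\<open>\<pi> (r\<^sup>-\<^sup>2 - b\<^sup>2 r\<^sup>2) (1 + O(r\<^sup>3))\<^sup>2\<close>. The terms \<open>r\<^sup>-\<^sup>2\<close> cancel and the error is \<open>O(r)\<close>, which is why
an ellipse rather than a disc has to be used: a disc would leave an error of constant size.\<close>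

theorem laurent_area_theorem:
  fixes e :: "complex \<Rightarrow> complex" and b :: real
  assumes e: "e holomorphic_on \<D>"
    and inj: "inj_on (\<lambda>z. 1 / z + b * z + z\<^sup>2 * e z) (\<D> - {0})"
  shows "b\<^sup>2 \<le> 1"
proof -
  define g where "g = (\<lambda>z::complex. 1 / z + b * z + z\<^sup>2 * e z)"
  define e' where "e' = (\<lambda>z::complex. 2 * e z + z * deriv e z)"
  define D where "D = (\<lambda>z::complex. - 1 / z + b * z + z\<^sup>2 * e' z)"
  have e': "e' holomorphic_on \<D>"
    unfolding e'_def by (intro holomorphic_intros e) auto
  have der_e: "(e has_field_derivative deriv e w) (at w)" if "w \<in> \<D>" for w
    using e that by (intro holomorphic_derivI[of e \<D>]) auto
  have der: "((\<lambda>z. g (exp z)) has_field_derivative D (exp z)) (at z)" if "exp z \<in> \<D>" for z :: complex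
  proof -
    have "(g has_field_derivative (- 1 / (exp z)\<^sup>2 + b + (2 * exp z * e (exp z) + (exp z)\<^sup>2 * deriv e (exp z)))) (at (exp z))"
      unfolding g_def
      by (rule derivative_eq_intros der_e[OF that] refl | simp add: field_simps power2_eq_square)+
    then have "((\<lambda>z. g (exp z)) has_field_derivative
      (- 1 / (exp z)\<^sup>2 + b + (2 * exp z * e (exp z) + (exp z)\<^sup>2 * deriv e (exp z))) * exp z) (at z)"
      by (rule DERIV_chain2) (rule DERIV_exp)
    also have "(- 1 / (exp z)\<^sup>2 + b + (2 * exp z * e (exp z) + (exp z)\<^sup>2 * deriv e (exp z))) * exp z = D (exp z)"
      by (simp add: D_def e'_def field_simps power2_eq_square)
    finally show ?thesis .
  qed
  have bound: "b\<^sup>2 * \<rho>\<^sup>2 \<le> 1 / \<rho>\<^sup>2" if \<rho>: "0 < \<rho>" "\<rho> < 1" for \<rho> :: real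
  proof -
    have "compact (e ` cball 0 \<rho>)"
      using \<rho> by (intro compact_continuous_image holomorphic_on_imp_continuous_on holomorphic_on_subset[OF e]) auto
    then obtain C where C: "C > 0" "\<And>z. z \<in> cball 0 \<rho> \<Longrightarrow> cmod (e z) \<le> C"
      using compact_imp_bounded[of "e ` cball 0 \<rho>"] unfolding bounded_pos by blast
    define M where "M = 2 * C + 1"
    have main: "1 / r\<^sup>2 - 1 / \<rho>\<^sup>2 + b\<^sup>2 * (\<rho>\<^sup>2 - r\<^sup>2) \<le> (1 / r\<^sup>2 - b\<^sup>2 * r\<^sup>2) * (1 + M * r ^ 3)\<^sup>2"
      if r: "0 < r" "r < \<rho>" "\<bar>b\<bar> * r \<le> 1 / 8" "C * r \<le> 1 / 16" for r
    proof -
      let ?A = "1 / r + b * r" and ?B = "1 / r - b * r"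
      let ?a = "ln r" and ?d = "ln \<rho>"
      let ?R = "box (Complex ?a 0) (Complex ?d (2*pi))"
      have expR: "exp z = of_real (exp (Re z)) * cis (Im z)" "r < exp (Re z)" "exp (Re z) < \<rho>" if "z \<in> ?R" for z
      proof -
        have z: "?a < Re z" "Re z < ?d" using that by (auto simp: in_box_complex_iff)
        then show "r < exp (Re z)" "exp (Re z) < \<rho>" using r \<rho> by (metis exp_less_cancel_iff exp_ln less_trans)+
        show "exp z = of_real (exp (Re z)) * cis (Im z)" by (simp add: exp_eq_polar)
      qed
      have inD: "exp z \<in> \<D>" if "z \<in> ?R" for z
      proof -
        have "exp (Re z) < 1" using expR(3)[OF that] \<rho> by linarith
        then show ?thesis by (simp only: mem_ball_0 norm_exp_eq_Re)
      qed
        have contD: "continuous_on (cbox (Complex ?a 0) (Complex ?d (2*pi))) (\<lambda>z. D (exp z))"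
        proof -
          have sub: "exp ` cbox (Complex ?a 0) (Complex ?d (2*pi)) \<subseteq> \<D>"
          proof (rule image_subsetI)
            fix z assume "z \<in> cbox (Complex ?a 0) (Complex ?d (2*pi))"
            then have "exp (Re z) \<le> \<rho>" using \<rho> by (simp add: in_cbox_complex_iff ln_ge_iff)
            then have "exp (Re z) < 1" using \<rho> by linarith
            then show "exp z \<in> \<D>" by (simp only: mem_ball_0 norm_exp_eq_Re)
          qed
          have "continuous_on (cbox (Complex ?a 0) (Complex ?d (2*pi))) (\<lambda>z. e' (exp z))"
            by (rule continuous_on_compose2[OF holomorphic_on_imp_continuous_on[OF e'] _ sub]) (intro continuous_intros)
          then show ?thesis unfolding D_def by (intro continuous_intros) auto
        qed
      have "integral {?a..?d} (\<lambda>s. integral {0..2*pi} (\<lambda>x. (cmod (D (exp (Complex s x))))\<^sup>2))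
         \<le> ?A * ?B * pi * (1 + M * r ^ 3)\<^sup>2"
      proof (rule conformal_area_bound)
        show "((\<lambda>z. g (exp z)) has_field_derivative D (exp z)) (at z)" if "z \<in> ?R" for z
          using that by (intro der inD)
        show "continuous_on (cbox (Complex ?a 0) (Complex ?d (2*pi))) (\<lambda>z. D (exp z))" by (rule contD)
        show "inj_on (\<lambda>z. g (exp z)) ?R"
        proof (rule inj_onI)
          fix z w assume zw: "z \<in> ?R" "w \<in> ?R" "g (exp z) = g (exp w)"
          then have "exp z = exp w"
            using inj inD by (auto simp: g_def dest!: inj_onD)
          moreover have "\<bar>Im z - Im w\<bar> < 2 * pi" using zw by (auto simp: in_box_complex_iff)
          ultimately show "z = w" by (rule exp_complex_eqI[rotated])
        qed
        have lo: "\<bar>c * r * r\<bar> < 1" if "\<bar>c\<bar> = \<bar>b\<bar>" for c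
        proof -
          have "\<bar>c * r * r\<bar> = \<bar>b\<bar> * r * r" using that r by (simp add: abs_mult)
          also have "\<dots> \<le> 1 / 8 * 1" using r \<rho> by (intro mult_mono) auto
          finally show ?thesis by simp
        qed
        show "?A > 0" "?B > 0" using lo[of b] r by (simp_all add: field_simps abs_less_iff power2_eq_square)
        show "0 \<le> 1 + M * r ^ 3" using C r by (simp add: M_def)
        show "(Re (g (exp z)) / ?A)\<^sup>2 + (Im (g (exp z)) / ?B)\<^sup>2 < (1 + M * r ^ 3)\<^sup>2" if z: "z \<in> ?R" for z
        proof -
          let ?t = "exp (Re z)" and ?w = "of_real (exp (Re z)) * cis (Im z)"
          have t: "r < ?t" "?t < \<rho>" using expR[OF z] by auto
          then have "cmod (e ?w) \<le> C" by (intro C(2)) (simp add: norm_mult)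
          then have "cmod (?w\<^sup>2 * e ?w) \<le> C * ?t\<^sup>2"
            by (simp add: norm_mult norm_power mult.commute mult_left_mono)
          moreover have "?t < 1" using t \<rho> by linarith
          ultimately show ?thesis
            unfolding g_def expR(1)[OF z] M_def using r t by (intro perturbed_ellipse_bound) auto
        qed
      qed
      also have "?A * ?B = 1 / r\<^sup>2 - b\<^sup>2 * r\<^sup>2" using r by (simp add: field_simps power2_eq_square)
      finally have up: "integral {?a..?d} (\<lambda>s. integral {0..2*pi} (\<lambda>x. (cmod (D (exp (Complex s x))))\<^sup>2))
         \<le> (1 / r\<^sup>2 - b\<^sup>2 * r\<^sup>2) * pi * (1 + M * r ^ 3)\<^sup>2" .
      \<comment> \<open>A primitive of the lower bound for the energy on the circle of radius \<open>exp s\<close>.\<close>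
      define G where "G = (\<lambda>s::real. pi * (b\<^sup>2 * (exp s)\<^sup>2 - 1 / (exp s)\<^sup>2))"
      have "((\<lambda>s. 2 * pi * (1 / (exp s)\<^sup>2 + b\<^sup>2 * (exp s)\<^sup>2)) has_integral G ?d - G ?a) {?a..?d}"
      proof (rule fundamental_theorem_of_calculus)
        show "?a \<le> ?d" using r by simp
        show "(G has_vector_derivative 2 * pi * (1 / (exp s)\<^sup>2 + b\<^sup>2 * (exp s)\<^sup>2)) (at s within {?a..?d})" for s
          unfolding G_def has_real_derivative_iff_has_vector_derivative[symmetric]
          by (auto intro!: derivative_eq_intros simp: field_simps power2_eq_square)
      qed
      moreover have "(\<lambda>s. integral {0..2*pi} (\<lambda>x. (cmod (D (exp (Complex s x))))\<^sup>2)) integrable_on {?a..?d}"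
      proof -
        have "continuous_on ({?a..?d} \<times> cbox 0 (2*pi)) (\<lambda>p. Complex (fst p) (snd p))"
          unfolding Complex_eq by (intro continuous_intros)
        then have "continuous_on ({?a..?d} \<times> cbox 0 (2*pi)) (\<lambda>p. D (exp (Complex (fst p) (snd p))))"
          by (rule continuous_on_compose2[OF contD]) (auto simp: in_cbox_complex_iff)
        then have "continuous_on ({?a..?d} \<times> cbox 0 (2*pi)) (\<lambda>(s, x). (cmod (D (exp (Complex s x))))\<^sup>2)"
          unfolding case_prod_unfold by (intro continuous_intros)
        from integral_continuous_on_param[OF this] show ?thesis
          by (intro integrable_continuous_real) (simp add: cbox_interval)
      qed
      moreover have "2 * pi * (1 / (exp s)\<^sup>2 + b\<^sup>2 * (exp s)\<^sup>2) \<le> integral {0..2*pi} (\<lambda>x. (cmod (D (exp (Complex s x))))\<^sup>2)"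
        if "s \<in> {?a..?d}" for s
      proof -
        have "exp s \<le> \<rho>" using that \<rho> by (simp add: ln_ge_iff)
        then have "exp s < 1" using \<rho> by linarith
        from circle_energy_lower_bound[OF e' exp_gt_zero this, of b] show ?thesis
          by (simp only: D_def exp_eq_polar complex.sel)
      qed
      ultimately have "G ?d - G ?a \<le> integral {?a..?d} (\<lambda>s. integral {0..2*pi} (\<lambda>x. (cmod (D (exp (Complex s x))))\<^sup>2))"
        using has_integral_le integrable_integral by blast
      also note up
      finally have "pi * (1 / r\<^sup>2 - 1 / \<rho>\<^sup>2 + b\<^sup>2 * (\<rho>\<^sup>2 - r\<^sup>2)) \<le> pi * ((1 / r\<^sup>2 - b\<^sup>2 * r\<^sup>2) * (1 + M * r ^ 3)\<^sup>2)"
        using r \<rho> by (simp add: G_def algebra_simps)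
      then show ?thesis by simp
    qed
    have "((\<lambda>r. (1 / r\<^sup>2 - b\<^sup>2 * r\<^sup>2) * (1 + M * r ^ 3)\<^sup>2 - 1 / r\<^sup>2 + b\<^sup>2 * r\<^sup>2) \<longlongrightarrow> 0) (at_right 0)"
      by real_asymp
    moreover have "\<forall>\<^sub>F r in at_right 0. b\<^sup>2 * \<rho>\<^sup>2 - 1 / \<rho>\<^sup>2 \<le> (1 / r\<^sup>2 - b\<^sup>2 * r\<^sup>2) * (1 + M * r ^ 3)\<^sup>2 - 1 / r\<^sup>2 + b\<^sup>2 * r\<^sup>2"
    proof -
      \<comment> \<open>The smallness conditions of the ellipse bound, satisfied below an explicit radius.\<close>
      define r0 where "r0 = min \<rho> (min (1 / (8 * (\<bar>b\<bar> + 1))) (1 / (16 * C)))"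
      have "r0 > 0" using \<rho> C by (simp add: r0_def)
      from eventually_at_right_real[OF this] show ?thesis
      proof eventually_elim
        case (elim r)
        then have r: "0 < r" "r < \<rho>" "r \<le> 1 / (8 * (\<bar>b\<bar> + 1))" "r \<le> 1 / (16 * C)" by (auto simp: r0_def)
        have "\<bar>b\<bar> * r \<le> (\<bar>b\<bar> + 1) * r" using r by simp
        also have "\<dots> \<le> 1 / 8" using r(3) by (simp add: field_simps)
        finally have "\<bar>b\<bar> * r \<le> 1 / 8" .
        moreover have "C * r \<le> 1 / 16" using r(4) C(1) by (simp add: field_simps)
        ultimately show ?case using main[of r] r by (simp add: algebra_simps)
      qed
    qed
    ultimately have "b\<^sup>2 * \<rho>\<^sup>2 - 1 / \<rho>\<^sup>2 \<le> 0"
      by (rule tendsto_lowerbound) auto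
    then show ?thesis by simp
  qed
  have "((\<lambda>\<rho>::real. b\<^sup>2 * \<rho>\<^sup>2 - 1 / \<rho>\<^sup>2) \<longlongrightarrow> b\<^sup>2 * 1\<^sup>2 - 1 / 1\<^sup>2) (at_left 1)"
    by (intro tendsto_intros) auto
  moreover have "\<forall>\<^sub>F \<rho> in at_left 1. b\<^sup>2 * \<rho>\<^sup>2 - 1 / \<rho>\<^sup>2 \<le> 0"
    by (rule eventually_mono[OF eventually_at_left_real[of 0 1]]) (use bound in auto)
  ultimately have "b\<^sup>2 * 1\<^sup>2 - 1 / 1\<^sup>2 \<le> 0"
    by (rule tendsto_upperbound) auto
  then show ?thesis by simp
qed

section \<open>Zalcman's inequality and its sharpness\<close>

lemma holomorphic_taylor_remainder:
  assumes f: "f holomorphic_on \<D>"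
  obtains \<psi> where "\<psi> holomorphic_on \<D>"
    and "\<And>z. z \<in> \<D> \<Longrightarrow> f z = (\<Sum>n<N. taylor_coeff f n * z ^ n) + z ^ N * \<psi> z"
proof
  define \<psi> where "\<psi> = (\<lambda>z. \<Sum>n. taylor_coeff f (n + N) * z ^ n)"
  have S: "(\<lambda>n. taylor_coeff f (n + N) * z ^ n) sums \<psi> z"
    and eq: "f z = (\<Sum>n<N. taylor_coeff f n * z ^ n) + z ^ N * \<psi> z" if "z \<in> \<D>" for z
  proof -
    have *: "(\<lambda>n. taylor_coeff f n * z ^ n) sums f z"
      using holomorphic_power_series[OF f that] by (simp add: taylor_coeff_eq)
    have "summable (\<lambda>n. taylor_coeff f (n + N) * z ^ n)"
    proof (cases "z = 0")
      case False
      have "summable (\<lambda>n. taylor_coeff f (n + N) * z ^ (n + N) * (1 / z ^ N))"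
        using * by (intro summable_mult2 summable_ignore_initial_segment sums_summable)
      then show ?thesis using False by (simp add: power_add)
    qed simp
    then show 1: "(\<lambda>n. taylor_coeff f (n + N) * z ^ n) sums \<psi> z"
      unfolding \<psi>_def by (rule summable_sums)
    from sums_mult[OF 1, of "z ^ N"] have "(\<lambda>n. taylor_coeff f (n + N) * z ^ (n + N)) sums (z ^ N * \<psi> z)"
      by (simp add: power_add mult_ac)
    moreover have "(\<lambda>n. taylor_coeff f (n + N) * z ^ (n + N)) sums (f z - (\<Sum>n<N. taylor_coeff f n * z ^ n))"
      using * by (rule sums_split_initial_segment)
    ultimately have "z ^ N * \<psi> z = f z - (\<Sum>n<N. taylor_coeff f n * z ^ n)" by (rule sums_unique2)
    then show "f z = (\<Sum>n<N. taylor_coeff f n * z ^ n) + z ^ N * \<psi> z" by simp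
  qed
  show "\<psi> holomorphic_on \<D>"
    by (rule power_series_holomorphic[where a = "\<lambda>n. taylor_coeff f (n + N)"]) (use S in simp)
  show "f z = (\<Sum>n<N. taylor_coeff f n * z ^ n) + z ^ N * \<psi> z" if "z \<in> \<D>" for z
    using eq that .
qed

text \<open>Since \<open>f\<close> has its only zero at the origin, \<open>1/f(z) + a 2 = 1/z + bz + O(z\<^sup>2)\<close> with
\<open>b = (a 2)\<^sup>2 - a 3\<close>, injective on the punctured disc, and the area theorem applies.\<close>

lemma class_S_real_area:
  assumes f: "f \<in> class_S_real"
  defines "a \<equiv> real_coeff f"
  shows "\<bar>(a 2)\<^sup>2 - a 3\<bar> \<le> 1"
proof -
  note D = class_S_realD[OF f]
  obtain \<psi> where \<psi>: "\<psi> holomorphic_on \<D>"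
    and f\<psi>: "\<And>z. z \<in> \<D> \<Longrightarrow> f z = (\<Sum>n<4. taylor_coeff f n * z ^ n) + z ^ 4 * \<psi> z"
    using holomorphic_taylor_remainder[OF D(1), of 4] by blast
  define b where "b = (a 2)\<^sup>2 - a 3"
  define \<phi> where "\<phi> = (\<lambda>z::complex. 1 + a 2 * z + a 3 * z\<^sup>2 + z ^ 3 * \<psi> z)"
  \<comment> \<open>\<open>1 - a 2 z + b z\<^sup>2\<close> is the start of \<open>1/\<phi>\<close>; its product with \<open>\<phi>\<close> is \<open>1 + z\<^sup>3 X\<close>.\<close>
  define X where "X = (\<lambda>z::complex. \<psi> z * (1 - a 2 * z + b * z\<^sup>2) + a 2 * b - a 2 * a 3 + a 3 * b * z)"
  have f\<phi>: "f z = z * \<phi> z" if "z \<in> \<D>" for z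
    using f\<psi>[OF that] D(3,4) class_S_real_coeff[OF f, of 2] class_S_real_coeff[OF f, of 3]
    by (simp add: \<phi>_def a_def eval_nat_numeral algebra_simps)
  have nz: "\<phi> z \<noteq> 0" if "z \<in> \<D>" for z
  proof (cases "z = 0")
    case False
    then have "f z \<noteq> f 0" using D(6) that by (auto dest: inj_onD)
    then show ?thesis using f\<phi>[OF that] D(2) by auto
  qed (simp add: \<phi>_def)
  have "\<phi> z * (1 - a 2 * z + b * z\<^sup>2) = 1 + z ^ 3 * X z" for z :: complex
    by (simp add: \<phi>_def X_def b_def power2_eq_square power3_eq_cube algebra_simps)
  then have recip: "1 / z + b * z + z\<^sup>2 * (- X z / \<phi> z) = 1 / f z + a 2" if "z \<in> \<D> - {0}" for z :: complex
    using nz[of z] f\<phi>[of z] that by (simp add: field_simps power2_eq_square power3_eq_cube)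
  have "b\<^sup>2 \<le> 1"
  proof (rule laurent_area_theorem)
    show "(\<lambda>z. - X z / \<phi> z) holomorphic_on \<D>"
      unfolding X_def \<phi>_def
      by (intro holomorphic_intros \<psi>) (use nz in \<open>auto simp: \<phi>_def\<close>)
    show "inj_on (\<lambda>z. 1 / z + b * z + z\<^sup>2 * (- X z / \<phi> z)) (\<D> - {0})"
    proof (rule inj_onI)
      fix z w :: complex assume zw: "z \<in> \<D> - {0}" "w \<in> \<D> - {0}"
        and "1 / z + b * z + z\<^sup>2 * (- X z / \<phi> z) = 1 / w + b * w + w\<^sup>2 * (- X w / \<phi> w)"
      then have "1 / f z = 1 / f w" by (simp only: recip add_right_cancel)
      then have "f z = f w" by simp
      then show "z = w" using D(6) zw by (auto dest: inj_onD)
    qed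
  qed
  then show ?thesis unfolding b_def by (simp add: abs_square_le_1)
qed

theorem class_S_real_zalcman:
  assumes f: "f \<in> class_S_real" and "n \<ge> 1" "m \<ge> 1"
  defines "a \<equiv> real_coeff f"
  shows "\<bar>a n * a m - a (n + m - 1)\<bar> \<le> (real n - 1) * (real m - 1)" "\<bar>a n\<bar> \<le> real n"
proof -
  interpret livingston_sequence a
  proof
    show "a 0 = 0" "a 1 = 1" using class_S_realD(3,4)[OF f] by (simp_all add: a_def real_coeff_def)
  qed (use class_S_real_livingston_inequality[OF f] in \<open>auto simp: a_def\<close>)
  show "\<bar>a n * a m - a (n + m - 1)\<bar> \<le> (real n - 1) * (real m - 1)"
    using class_S_real_area[OF f] assms by (intro zalcman) auto
  show "\<bar>a n\<bar> \<le> real n" using growth assms by simp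
qed

definition koebe :: "complex \<Rightarrow> complex" where
  "koebe z = z / (1 - z)\<^sup>2"

lemma taylor_coeff_koebe: "taylor_coeff koebe n = of_nat n"
proof -
  define K :: "complex fps" where "K = Abs_fps of_nat"
  have s: "(\<lambda>n. of_nat n * z ^ n) sums koebe z" if "norm z < 1" for z :: complex
  proof -
    have "(\<lambda>n. of_nat (Suc n) * z ^ n * z) sums (1 / (1 - z)\<^sup>2 * z)"
      using that by (intro sums_mult2 geometric_deriv_sums)
    then have "(\<lambda>n. of_nat (Suc n) * z ^ Suc n) sums koebe z" by (simp add: koebe_def mult_ac)
    then show ?thesis using sums_Suc_iff[of "\<lambda>n. of_nat n * z ^ n" "koebe z"] by simp
  qed
  have "koebe has_fps_expansion K"
    unfolding has_fps_expansion_def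
  proof
    have "summable (\<lambda>n. of_nat n * (1/2) ^ n :: complex)" using s[of "1/2"] by (auto simp: sums_iff)
    then have "norm (1/2 :: complex) \<le> conv_radius (fps_nth K)"
      by (intro conv_radius_geI) (simp add: K_def)
    moreover have "(0::ereal) < norm (1/2 :: complex)" by simp
    ultimately show "fps_conv_radius K > 0" unfolding fps_conv_radius_def by (rule order.strict_trans2[rotated])
    have "\<forall>\<^sub>F z in nhds (0::complex). z \<in> ball 0 1" by (intro eventually_nhds_in_open) auto
    then show "\<forall>\<^sub>F z in nhds 0. eval_fps K z = koebe z"
      by eventually_elim (use s in \<open>auto simp: eval_fps_def K_def sums_iff\<close>)
  qed
  from fps_nth_fps_expansion[OF this, of n] show ?thesis
    by (simp add: taylor_coeff_eq K_def)
qed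

lemma koebe_in_class_S_real: "koebe \<in> class_S_real"
proof -
  have "koebe analytic_on \<D>"
    unfolding koebe_def by (intro analytic_intros) auto
  moreover have "inj_on koebe \<D>"
  proof (rule inj_onI)
    fix z w assume zw: "z \<in> \<D>" "w \<in> \<D>" "koebe z = koebe w"
    then have ne: "1 - z \<noteq> 0" "1 - w \<noteq> 0" by auto
    have "z * (1 - w)\<^sup>2 = w * (1 - z)\<^sup>2"
      using zw(3) ne by (simp add: koebe_def frac_eq_eq)
    then have "(z - w) * (1 - z * w) = 0" by (simp add: power2_eq_square algebra_simps)
    moreover have "norm (z * w) < 1 * 1"
      unfolding norm_mult using zw by (intro mult_strict_mono') auto
    then have "z * w \<noteq> 1" by auto
    ultimately show "z = w" by simp
  qed
  ultimately show ?thesis by (simp add: class_S_real_def class_A_def taylor_coeff_koebe)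
qed

theorem corollary3p4:
  fixes l :: real and n m :: nat
  assumes "l \<ge> 1" and "n \<ge> 2" and "m \<ge> 2"
  shows "(\<forall>f \<in> class_S_real.
            cmod (of_real l * taylor_coeff f n * taylor_coeff f m - taylor_coeff f (n + m - 1))
              \<le> l * real m * real n - real n - real m + 1)
       \<and> (\<exists>f \<in> class_S_real.
            cmod (of_real l * taylor_coeff f n * taylor_coeff f m - taylor_coeff f (n + m - 1))
              = l * real m * real n - real n - real m + 1)"
proof (intro conjI ballI)
  fix f assume f: "f \<in> class_S_real"
  define a where "a = real_coeff f"
  have Z: "\<bar>a n * a m - a (n + m - 1)\<bar> \<le> (real n - 1) * (real m - 1)" "\<bar>a n\<bar> \<le> real n" "\<bar>a m\<bar> \<le> real m"
    using class_S_real_zalcman[OF f, of n m] class_S_real_zalcman[OF f, of m n] assms by (auto simp: a_def)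
  have "of_real l * taylor_coeff f n * taylor_coeff f m - taylor_coeff f (n + m - 1)
      = complex_of_real (l * a n * a m - a (n + m - 1))"
    by (simp add: class_S_real_coeff[OF f] a_def)
  then have "cmod (of_real l * taylor_coeff f n * taylor_coeff f m - taylor_coeff f (n + m - 1))
      = \<bar>l * a n * a m - a (n + m - 1)\<bar>" by (simp only: norm_of_real)
  \<comment> \<open>The excess \<open>l - 1\<close> only needs the growth bound \<open>\<bar>a n\<bar> \<le> n\<close>; the rest is the case \<open>l = 1\<close>.\<close>
  also have "l * a n * a m - a (n + m - 1) = (l - 1) * (a n * a m) + (a n * a m - a (n + m - 1))"
    by (simp add: algebra_simps)
  also have "\<bar>\<dots>\<bar> \<le> \<bar>(l - 1) * (a n * a m)\<bar> + \<bar>a n * a m - a (n + m - 1)\<bar>" by (rule abs_triangle_ineq)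
  also have "\<dots> \<le> (l - 1) * (real n * real m) + (real n - 1) * (real m - 1)"
  proof (rule add_mono[OF _ Z(1)])
    have "\<bar>a n * a m\<bar> \<le> real n * real m" unfolding abs_mult using Z by (intro mult_mono) auto
    then show "\<bar>(l - 1) * (a n * a m)\<bar> \<le> (l - 1) * (real n * real m)"
      using \<open>l \<ge> 1\<close> by (simp add: abs_mult[of "l - 1"] mult_left_mono)
  qed
  also have "\<dots> = l * real m * real n - real n - real m + 1" by (simp add: algebra_simps)
  finally show "cmod (of_real l * taylor_coeff f n * taylor_coeff f m - taylor_coeff f (n + m - 1))
      \<le> l * real m * real n - real n - real m + 1" .
next
  have pos: "0 \<le> l * real m * real n - real n - real m + 1"
  proof -
    have "0 \<le> (l - 1) * (real m * real n) + (real n - 1) * (real m - 1)"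
      using assms by (intro add_nonneg_nonneg mult_nonneg_nonneg) auto
    then show ?thesis by (simp add: algebra_simps)
  qed
  have "of_real l * taylor_coeff koebe n * taylor_coeff koebe m - taylor_coeff koebe (n + m - 1)
      = complex_of_real (l * real m * real n - real n - real m + 1)"
    using assms by (simp add: taylor_coeff_koebe of_nat_diff)
  then have "cmod (of_real l * taylor_coeff koebe n * taylor_coeff koebe m - taylor_coeff koebe (n + m - 1))
      = l * real m * real n - real n - real m + 1"
    using pos by (simp only: norm_of_real abs_of_nonneg)
  then show "\<exists>f \<in> class_S_real.
            cmod (of_real l * taylor_coeff f n * taylor_coeff f m - taylor_coeff f (n + m - 1))
              = l * real m * real n - real n - real m + 1"
    using koebe_in_class_S_real by blast
qed

end
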